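(* Let $0<r<1$. Consider two trajectories of four one-dimensional inelastic particles colliding with restitution coefficient $r$, denoted by $(p(k),q(k))_{k\in\mathbb{N}}$ and $(p'(k),q'(k))_{k\in\mathbb{N}}$. Assume that both trajectories present infinitely many collisions, starting from the respective initial configurations $(p(0),q(0))$ and $(p'(0),q'(0))\in\mathbb{S}^2\times\mathbb{S}^2$, that the same pairs of particles are in contact initially, i.e. $$\forall j\in\{1,2,3\},\quad p_j(0)=0\iff p_j'(0)=0,$$ and that the initial configurations generate the same plane, i.e. $$\operatorname{Span}(p(0),q(0))=\operatorname{Span}(p'(0),q'(0)).$$ Then the two trajectories generate the same planes at each collision: $$\forall k\in\mathbb{N}^*,\quad \operatorname{Span}(p(k),q(k))=\operatorname{Span}(p'(k),q'(k)).$$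
   Context: **Particle system.** Four identical point particles move on $\mathbb{R}$ with positions $x_1\le x_2\le x_3\le x_4$ and velocities $v_1,\dots,v_4$. Set $p_i=x_{i+1}-x_i\ge 0$ and $q_i=v_{i+1}-v_i$ for $i=1,2,3$, $p=(p_1,p_2,p_3)\in(\mathbb{R}_+)^3$, $q=(q_1,q_2,q_3)\in\mathbb{R}^3$. Between collisions $q$ is constant and $p$ evolves by $\dot p=q$. When $p_i$ reaches $0$, particles $i$ and $i+1$ collide inelastically: $v_i'+v_{i+1}'=v_i+v_{i+1}$ and $v_i'-v_{i+1}'=-r(v_i-v_{i+1})$, the other velocities being unchanged. Equivalently the post-collisional vector is $Kq$, with $q$ the pre-collisional one and $K$ one of $$A=\begin{pmatrix}-r&0&0\\ \frac{1+r}{2}&1&0\\0&0&1\end{pmatrix},\quad B=\begin{pmatrix}1&\frac{1+r}{2}&0\\0&-r&0\\0&\frac{1+r}{2}&1\end{pmatrix},\quad C=\begin{pmatrix}1&0&0\\0&1&\frac{1+r}{2}\\0&0&-r\end{pmatrix},$$ where $K=A$ if $p_1=0$ (type $\mathfrak a$), $K=B$ if $p_2=0$ (type $\mathfrak b$), $K=C$ if $p_3=0$ (type $\mathfrak c$). If $p_1$ and $p_3$ reach $0$ simultaneously, both $A$ and $C$ are applied ($AC=CA$). The dynamics is not defined when $p_1=p_2=0$ or $p_2=p_3=0$ (triple collision); along the trajectories considered this never occurs. **Time discretization.** $0=t_0<t_1<t_2<\dots$ are the successive collision times, and $p(k)=p(t_k)$, $q(k)=q(t_k)$, where velocities at collision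 times are the post-collisional ones by convention. The initial configuration is taken right after a collision: at least one component $p_j(0)$ vanishes, and $q_j(0)>0$ for every $j$ with $p_j(0)=0$ (the same for $(p'(0),q'(0))$). $\mathbb{S}^2$ is the unit sphere of $\mathbb{R}^3$; $\mathbb{N}^*=\{1,2,\dots\}$. *)

theory Defs
  imports "HOL-Analysis.Analysis"
begin

text \<open>The vector \<open>(y\<^sub>2 - y\<^sub>1, y\<^sub>3 - y\<^sub>2, y\<^sub>4 - y\<^sub>3)\<close>. It yields \<open>p\<close> from the four positions
  and \<open>q\<close> from the four velocities.\<close>

definition gaps :: "real^4 \<Rightarrow> real^3" where
  "gaps y = vector [y $ 2 - y $ 1, y $ 3 - y $ 2, y $ 4 - y $ 3]"

definition matA :: "real \<Rightarrow> real^3^3" where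
  "matA r = vector [vector [-r, 0, 0],
                    vector [(1 + r) / 2, 1, 0],
                    vector [0, 0, 1]]"

definition matB :: "real \<Rightarrow> real^3^3" where
  "matB r = vector [vector [1, (1 + r) / 2, 0],
                    vector [0, -r, 0],
                    vector [0, (1 + r) / 2, 1]]"

definition matC :: "real \<Rightarrow> real^3^3" where
  "matC r = vector [vector [1, 0, 0],
                    vector [0, 1, (1 + r) / 2],
                    vector [0, 0, -r]]"

text \<open>The matrices are those induced on the relative velocities by the inelastic collision rule
  for the particle velocities.\<close>

lemma matA_collision_rule:
  assumes "v' $ 1 + v' $ 2 = v $ 1 + v $ 2" "v' $ 1 - v' $ 2 = - r * (v $ 1 - v $ 2)"
    and "v' $ 3 = v $ 3" "v' $ 4 = v $ 4"
  shows "gaps v' = matA r *v gaps v"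
proof -
  have "v' $ 2 = (v $ 1 + v $ 2 + r * (v $ 1 - v $ 2)) / 2"
    and "v' $ 1 = (v $ 1 + v $ 2 - r * (v $ 1 - v $ 2)) / 2"
    using assms(1,2) by auto
  then show ?thesis
    using assms(3,4)
    by (simp add: gaps_def matA_def vec_eq_iff forall_3 matrix_vector_mult_def sum_3 field_simps)
qed

lemma matB_collision_rule:
  assumes "v' $ 2 + v' $ 3 = v $ 2 + v $ 3" "v' $ 2 - v' $ 3 = - r * (v $ 2 - v $ 3)"
    and "v' $ 1 = v $ 1" "v' $ 4 = v $ 4"
  shows "gaps v' = matB r *v gaps v"
proof -
  have "v' $ 3 = (v $ 2 + v $ 3 + r * (v $ 2 - v $ 3)) / 2"
    and "v' $ 2 = (v $ 2 + v $ 3 - r * (v $ 2 - v $ 3)) / 2"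
    using assms(1,2) by auto
  then show ?thesis
    using assms(3,4)
    by (simp add: gaps_def matB_def vec_eq_iff forall_3 matrix_vector_mult_def sum_3 field_simps)
qed

lemma matC_collision_rule:
  assumes "v' $ 3 + v' $ 4 = v $ 3 + v $ 4" "v' $ 3 - v' $ 4 = - r * (v $ 3 - v $ 4)"
    and "v' $ 1 = v $ 1" "v' $ 2 = v $ 2"
  shows "gaps v' = matC r *v gaps v"
proof -
  have "v' $ 4 = (v $ 3 + v $ 4 + r * (v $ 3 - v $ 4)) / 2"
    and "v' $ 3 = (v $ 3 + v $ 4 - r * (v $ 3 - v $ 4)) / 2"
    using assms(1,2) by auto
  then show ?thesis
    using assms(3,4)
    by (simp add: gaps_def matC_def vec_eq_iff forall_3 matrix_vector_mult_def sum_3 field_simps)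
qed

definition triple_contact :: "real^3 \<Rightarrow> bool" where
  "triple_contact p \<longleftrightarrow> (p $ 1 = 0 \<and> p $ 2 = 0) \<or> (p $ 2 = 0 \<and> p $ 3 = 0)"

text \<open>The matrix applied to the pre-collisional \<open>q\<close> when the gaps are \<open>p\<close>. It is only meaningful if
  some component of \<open>p\<close> vanishes and \<open>p\<close> is not a triple contact; elsewhere its value is irrelevant,
  since trajectories below never evaluate it there.\<close>

definition collision_matrix :: "real \<Rightarrow> real^3 \<Rightarrow> real^3^3" where
  "collision_matrix r p =
     (if p $ 1 = 0 \<and> p $ 3 = 0 then matA r ** matC r
      else if p $ 1 = 0 then matA r
      else if p $ 2 = 0 then matB r
      else if p $ 3 = 0 then matC r
      else mat 1)"

definition initial_configuration :: "real^3 \<Rightarrow> real^3 \<Rightarrow> bool" where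
  "initial_configuration p q \<longleftrightarrow>
     (\<forall>j. 0 \<le> p $ j) \<and> (\<exists>j. p $ j = 0) \<and> (\<forall>j. p $ j = 0 \<longrightarrow> 0 < q $ j) \<and> \<not> triple_contact p"

text \<open>One step of the time-discretized dynamics: starting at time \<open>s\<close> from \<open>(p, q)\<close> with
  \<open>q\<close> post-collisional, \<open>s'\<close> is the first later time at which a component of the freely evolving
  gap vector vanishes, and \<open>(p', q')\<close> is the configuration at time \<open>s'\<close>, right after the
  collision.\<close>

definition next_collision ::
    "real \<Rightarrow> real \<Rightarrow> real^3 \<Rightarrow> real^3 \<Rightarrow> real \<Rightarrow> real^3 \<Rightarrow> real^3 \<Rightarrow> bool" where
  "next_collision r s p q s' p' q' \<longleftrightarrow>
     s < s' \<and>
     (\<forall>u. s < u \<and> u < s' \<longrightarrow> (\<forall>j. 0 < (p + (u - s) *\<^sub>R q) $ j)) \<and>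
     p' = p + (s' - s) *\<^sub>R q \<and>
     (\<exists>j. p' $ j = 0) \<and>
     \<not> triple_contact p' \<and>
     q' = collision_matrix r p' *v q"

text \<open>A trajectory with infinitely many collisions: \<open>t k\<close> are the successive collision times, and
  \<open>(p k, q k)\<close> is the configuration at time \<open>t k\<close>, with post-collisional velocities. The times
  \<open>t k\<close> may accumulate at a finite time (inelastic collapse).\<close>

definition infinite_trajectory ::
    "real \<Rightarrow> (nat \<Rightarrow> real) \<Rightarrow> (nat \<Rightarrow> real^3) \<Rightarrow> (nat \<Rightarrow> real^3) \<Rightarrow> bool" where
  "infinite_trajectory r t p q \<longleftrightarrow>
     t 0 = 0 \<and> initial_configuration (p 0) (q 0) \<and>
     (\<forall>k. next_collision r (t k) (p k) (q k) (t (Suc k)) (p (Suc k)) (q (Suc k)))"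

end

theory Submission
  imports Defs
begin

text \<open>
  A collision sees only directions. Between two collisions the point \<open>p + \<tau> q\<close> sweeps the
  half-plane bounded by the line through \<open>p\<close> and containing \<open>q\<close>, and the next collision happens
  when it leaves the positive octant. The sector cut out of this half-plane by the octant has two
  extreme rays: the motion starts on one and ends on the other. Hence two trajectories that start
  on the same ray and enter the same half-plane reach their next collision on the same ray
  (\<open>same_flag_exit\<close>), although in general at different points and times.

  Being on the same ray, they undergo the same type of collision, with the same matrix \<open>K\<close>. It
  fixes the contact position, because the components that \<open>K\<close> alters are driven by the
  vanishing gaps (\<open>collision_matrix_fixes_contact\<close>). So \<open>K\<close> maps the half-plane to a half-plane with
  the same boundary ray, and the two trajectories again share a ray and a half-plane: the shared
  flag is an invariant (\<open>same_flag_next_collision\<close>), and it determines the plane.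

  It remains to obtain the flag from the plane at time \<open>0\<close>. If particles \<open>j\<close> and \<open>j + 1\<close> are in
  contact in both initial configurations, both positions lie on the line where the plane meets
  \<open>x\<^sub>j = 0\<close>. Nonnegativity of the gaps orients this line, and the sign of the outgoing relative
  velocity \<open>q\<^sub>j\<close> selects the half-plane (\<open>same_flag_initial\<close>).
\<close>

text \<open>The two pairs determine the same ray through the first vector and the same half-plane, bounded
  by the line of that ray, through the second. The coefficient \<open>a\<close> is unconstrained because
  adding multiples of \<open>p\<close> to \<open>q\<close> does not change the half-plane.\<close>

definition same_flag ::
    "'a::real_vector \<Rightarrow> 'a \<Rightarrow> 'a \<Rightarrow> 'a \<Rightarrow> bool" where
  "same_flag p q p' q' \<longleftrightarrow>
     (\<exists>l a b. 0 < l \<and> 0 < b \<and> p' = l *\<^sub>R p \<and> q' = a *\<^sub>R p + b *\<^sub>R q)"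

lemma same_flag_span:
  assumes "same_flag p q p' q'"
  shows "span {p, q} = span {p', q'}"
proof -
  obtain l a b where pos: "0 < l" "0 < b"
    and p': "p' = l *\<^sub>R p" and q': "q' = a *\<^sub>R p + b *\<^sub>R q"
    using assms unfolding same_flag_def by blast
  have p: "p = (1 / l) *\<^sub>R p'"
    using pos p' by simp
  have "b *\<^sub>R q = q' - (a / l) *\<^sub>R p'"
    using pos p' q' by simp
  then have q: "q = (1 / b) *\<^sub>R (q' - (a / l) *\<^sub>R p')"
    using pos by (metis divide_self_if less_irrefl scaleR_one scaleR_scaleR times_divide_eq_left mult_1)
  have "p' \<in> span {p, q}" "q' \<in> span {p, q}"
    unfolding p' q' by (intro span_add span_scale span_base; simp)+
  moreover have "p \<in> span {p', q'}"
    by (subst p) (intro span_scale span_base; simp)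
  moreover have "q \<in> span {p', q'}"
    by (subst q) (intro span_diff span_scale span_base; simp)
  ultimately show ?thesis
    unfolding span_eq by simp
qed

text \<open>Both motions turn within the common half-plane, from the ray of \<open>p\<close> towards \<open>q\<close>, and leave
  the open orthant on the first ray that is not inside it. In coordinates along \<open>p\<close> and \<open>q\<close>, the
  second motion would meet the ray of \<open>p + T q\<close> at the time \<open>\<sigma>\<close> with \<open>\<sigma> (b - a T) = T l\<close>. If
  \<open>T'\<close> were later, the second motion would already have left the orthant at \<open>\<sigma>\<close>; if \<open>T'\<close> were
  earlier, it would end on a ray that the first motion meets inside the orthant.\<close>

lemma same_flag_exit:
  fixes p q p' q' :: "real^'n"
  assumes flag: "p' = l *\<^sub>R p" "q' = a *\<^sub>R p + b *\<^sub>R q" "0 < l" "0 < b"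
    and T: "0 < T" "\<And>\<tau> j. 0 < \<tau> \<Longrightarrow> \<tau> < T \<Longrightarrow> 0 < (p + \<tau> *\<^sub>R q) $ j"
      "(p + T *\<^sub>R q) $ i = 0"
    and T': "0 < T'" "\<And>\<tau> j. 0 < \<tau> \<Longrightarrow> \<tau> < T' \<Longrightarrow> 0 < (p' + \<tau> *\<^sub>R q') $ j"
      "(p' + T' *\<^sub>R q') $ i' = 0"
  shows "0 < l + a * T'" and "p' + T' *\<^sub>R q' = (l + a * T') *\<^sub>R (p + T *\<^sub>R q)"
    and "0 < b - a * T"
proof -
  have motion: "p' + \<tau> *\<^sub>R q' = (l + a * \<tau>) *\<^sub>R p + (b * \<tau>) *\<^sub>R q" for \<tau>
    by (simp add: flag algebra_simps)
  have Tl: "0 < T * l"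
    using T(1) flag(3) by simp
  have not_later: "\<not> T * l < T' * (b - a * T)"
  proof
    assume later: "T * l < T' * (b - a * T)"
    then have d: "0 < b - a * T"
      using Tl T'(1) by (meson less_trans zero_less_mult_pos)
    define \<sigma> where "\<sigma> = T * l / (b - a * T)"
    have \<sigma>: "0 < \<sigma>" "\<sigma> < T'"
      using d Tl later by (simp_all add: \<sigma>_def divide_less_eq)
    have "\<sigma> * (b - a * T) = T * l"
      using d by (simp add: \<sigma>_def)
    then have "b * \<sigma> = (l + a * \<sigma>) * T"
      by (simp add: algebra_simps)
    then have "p' + \<sigma> *\<^sub>R q' = (l + a * \<sigma>) *\<^sub>R (p + T *\<^sub>R q)"
      by (simp add: motion scaleR_add_right)
    then have "(p' + \<sigma> *\<^sub>R q') $ i = 0"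
      using T(3) by (simp only: vector_scaleR_component) simp
    then show False
      using T'(2)[OF \<sigma>, of i] by simp
  qed
  have not_earlier: "\<not> T' * (b - a * T) < T * l"
  proof
    assume "T' * (b - a * T) < T * l"
    then have lt: "b * T' < T * (l + a * T')"
      by (simp add: algebra_simps)
    have "0 < b * T'"
      using flag(4) T'(1) by simp
    then have D: "0 < l + a * T'"
      using lt T(1) by (meson less_trans zero_less_mult_pos)
    define \<sigma> where "\<sigma> = b * T' / (l + a * T')"
    have \<sigma>: "0 < \<sigma>" "\<sigma> < T"
      using D \<open>0 < b * T'\<close> lt by (simp_all add: \<sigma>_def divide_less_eq)
    have "b * T' = (l + a * T') * \<sigma>"
      using D by (simp add: \<sigma>_def)
    then have "p' + T' *\<^sub>R q' = (l + a * T') *\<^sub>R (p + \<sigma> *\<^sub>R q)"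
      by (simp add: motion scaleR_add_right)
    then have "(p' + T' *\<^sub>R q') $ i' = (l + a * T') * (p + \<sigma> *\<^sub>R q) $ i'"
      by (simp only: vector_scaleR_component real_scaleR_def)
    then show False
      using T'(3) T(2)[OF \<sigma>, of i'] D by simp
  qed
  have eq: "T' * (b - a * T) = T * l"
    using not_later not_earlier by simp
  then show "0 < b - a * T"
    using Tl T'(1) by (metis zero_less_mult_pos)
  have bT: "b * T' = T * (l + a * T')"
    using eq by (simp add: algebra_simps)
  then show "0 < l + a * T'"
    using flag(4) T'(1) T(1) by (metis mult_pos_pos zero_less_mult_pos)
  show "p' + T' *\<^sub>R q' = (l + a * T') *\<^sub>R (p + T *\<^sub>R q)"
    using bT by (simp add: motion scaleR_add_right mult.commute)
qed

text \<open>Each collision matrix differs from the identity only in the columns of the vanishing gaps.\<close>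

lemma collision_matrix_fixes_contact: "collision_matrix r p *v p = p"
  by (simp add: collision_matrix_def matA_def matB_def matC_def vec_eq_iff forall_3
      matrix_vector_mult_def matrix_matrix_mult_def sum_3 mat_def)

lemma collision_matrix_scaleR:
  "c \<noteq> 0 \<Longrightarrow> collision_matrix r (c *\<^sub>R p) = collision_matrix r p"
  by (simp add: collision_matrix_def)

lemma next_collisionD:
  assumes "next_collision r s p q s1 p1 q1"
  shows "0 < s1 - s"
    and "\<And>\<tau> j. 0 < \<tau> \<Longrightarrow> \<tau> < s1 - s \<Longrightarrow> 0 < (p + \<tau> *\<^sub>R q) $ j"
    and "p1 = p + (s1 - s) *\<^sub>R q"
    and "\<exists>j. (p + (s1 - s) *\<^sub>R q) $ j = 0"
    and "q1 = collision_matrix r p1 *v q"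
proof -
  show "0 < (p + \<tau> *\<^sub>R q) $ j" if "0 < \<tau>" "\<tau> < s1 - s" for \<tau> j
  proof -
    have "s < s + \<tau> \<and> s + \<tau> < s1"
      using that by auto
    then have "0 < (p + (s + \<tau> - s) *\<^sub>R q) $ j"
      using assms unfolding next_collision_def by blast
    then show ?thesis by simp
  qed
qed (use assms in \<open>auto simp: next_collision_def\<close>)

text \<open>With \<open>p\<^sub>1 = p + T q\<close>, the second incoming velocity is \<open>q' = a p\<^sub>1 + (b - a T) q\<close>. The common
  collision matrix fixes \<open>p\<^sub>1\<close> and maps \<open>q\<close> to \<open>q\<^sub>1\<close>, so the same coefficients relate the outgoing
  velocities.\<close>

lemma same_flag_next_collision:
  assumes "same_flag p q p' q'"
    and nc: "next_collision r s p q s1 p1 q1"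
    and nc': "next_collision r s' p' q' s1' p1' q1'"
  shows "same_flag p1 q1 p1' q1'"
proof -
  obtain l a b where flag: "p' = l *\<^sub>R p" "q' = a *\<^sub>R p + b *\<^sub>R q" "0 < l" "0 < b"
    using assms(1) unfolding same_flag_def by blast
  note D = next_collisionD[OF nc] and D' = next_collisionD[OF nc']
  define T T' where "T = s1 - s" and "T' = s1' - s'"
  obtain i i' where "(p + T *\<^sub>R q) $ i = 0" "(p' + T' *\<^sub>R q') $ i' = 0"
    using D(4) D'(4) unfolding T_def T'_def by blast
  note E = same_flag_exit[OF flag D(1,2) this(1)[unfolded T_def] D'(1,2) this(2)[unfolded T'_def],
      folded T_def T'_def]
  have p1: "p1 = p + T *\<^sub>R q"
    using D(3) by (simp add: T_def)
  have p1': "p1' = (l + a * T') *\<^sub>R p1"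
    using D'(3) E(2) by (simp add: T'_def p1)
  let ?K = "collision_matrix r p1"
  have "q' = a *\<^sub>R p1 + (b - a * T) *\<^sub>R q"
    by (simp add: flag(2) p1 algebra_simps)
  moreover have "collision_matrix r p1' = ?K"
    unfolding p1' by (rule collision_matrix_scaleR) (use E(1) in simp)
  ultimately have "q1' = ?K *v (a *\<^sub>R p1 + (b - a * T) *\<^sub>R q)"
    using D'(5) by simp
  also have "\<dots> = a *\<^sub>R (?K *v p1) + (b - a * T) *\<^sub>R (?K *v q)"
    by (simp only: matrix_vector_right_distrib matrix_vector_mult_scaleR)
  also have "\<dots> = a *\<^sub>R p1 + (b - a * T) *\<^sub>R q1"
    using D(5) by (simp add: collision_matrix_fixes_contact)
  finally show ?thesis
    using E(1,3) p1' unfolding same_flag_def by blast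
qed

text \<open>A shared vanishing gap \<open>j\<close> with \<open>q\<^sub>j > 0\<close> turns equality of planes into equality of flags:
  the \<open>j\<close>-th component reads off the coefficient of \<open>q\<close> in a vector of the plane.\<close>

lemma same_flag_initial:
  fixes p q p' q' :: "real^'n"
  assumes nonneg: "\<forall>i. 0 \<le> p $ i" "\<forall>i. 0 \<le> p' $ i"
    and contact: "p $ j = 0" "p' $ j = 0"
    and outgoing: "0 < q $ j" "0 < q' $ j"
    and nonzero: "p' \<noteq> 0"
    and span: "p' \<in> span {p, q}" "q' \<in> span {p, q}"
  shows "same_flag p q p' q'"
proof -
  have coeffs: "\<exists>a b. x = a *\<^sub>R p + b *\<^sub>R q" if "x \<in> span {p, q}" for x
    using that by (auto simp: span_insert span_singleton algebra_simps)
  obtain l c where p': "p' = l *\<^sub>R p + c *\<^sub>R q"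
    using coeffs[OF span(1)] by blast
  obtain a b where q': "q' = a *\<^sub>R p + b *\<^sub>R q"
    using coeffs[OF span(2)] by blast
  have "c * q $ j = 0"
    using contact p' by simp
  then have p'_ray: "p' = l *\<^sub>R p"
    using outgoing(1) p' by simp
  obtain i where "p' $ i \<noteq> 0"
    using nonzero by (auto simp: vec_eq_iff)
  then have "0 < l * p $ i"
    using nonneg(2) p'_ray by (metis less_le vector_scaleR_component real_scaleR_def)
  then have l: "0 < l"
    using nonneg(1) by (metis zero_less_mult_pos2 less_le mult_zero_right)
  have "q' $ j = b * q $ j"
    using contact(1) q' by simp
  then have "0 < b"
    using outgoing by (metis zero_less_mult_pos2)
  then show ?thesis
    using l p'_ray q' unfolding same_flag_def by blast
qed

theorem theorem4p1:
  fixes r :: real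
    and t t' :: "nat \<Rightarrow> real"
    and p q p' q' :: "nat \<Rightarrow> real^3"
  assumes "0 < r" "r < 1"
    and "infinite_trajectory r t p q"
    and "infinite_trajectory r t' p' q'"
    and "(p 0, q 0) \<in> sphere 0 1 \<times> sphere 0 1"
    and "(p' 0, q' 0) \<in> sphere 0 1 \<times> sphere 0 1"
    and "\<forall>j. p 0 $ j = 0 \<longleftrightarrow> p' 0 $ j = 0"
    and "span {p 0, q 0} = span {p' 0, q' 0}"
  shows "\<forall>k\<ge>1. span {p k, q k} = span {p' k, q' k}"
proof -
  have init: "initial_configuration (p 0) (q 0)" "initial_configuration (p' 0) (q' 0)"
    using assms(3,4) by (simp_all add: infinite_trajectory_def)
  obtain j where j: "p 0 $ j = 0"
    using init(1) unfolding initial_configuration_def by blast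
  then have j': "p' 0 $ j = 0"
    using assms(7) by blast
  have "same_flag (p 0) (q 0) (p' 0) (q' 0)"
  proof (rule same_flag_initial[OF _ _ j j'])
    show "p' 0 \<noteq> 0"
      using assms(6) by auto
    show "p' 0 \<in> span {p 0, q 0}" "q' 0 \<in> span {p 0, q 0}"
      unfolding assms(8) by (auto intro: span_base)
  qed (use init j j' in \<open>auto simp: initial_configuration_def\<close>)
  then have "same_flag (p k) (q k) (p' k) (q' k)" for k
  proof (induction k)
    case (Suc k)
    then show ?case
      using assms(3,4) unfolding infinite_trajectory_def
      by (blast intro: same_flag_next_collision)
  qed
  then show ?thesis
    using same_flag_span by blast
qed

end
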